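(* Let $H:\mathbb{C}^N\to\mathbb{C}^N$ be the LTI filter with impulse response $h\in\mathbb{C}^N$, and let $\alpha,\beta\ge1$ be integers dividing $N$, with $A=N/\alpha$, $B=N/\beta$. If $H$ can be written as a Gabor multiplier, $H=\mathsf{G}^{g_1,g_2}_a$, with lattice constants $\alpha,\beta$, for some symbol $a\in\mathbb{C}^{N\times N}$ and windows $g_1,g_2\in\mathbb{C}^N$, then for every $u\in\operatorname{supp}(h)$: 1) $V_{g_1}g_2(u,0)=(\overline{\mathcal{I}g_1}\ast g_2)(u)\ne0$; 2) $V_{g_1}g_2(u+Bk,lA)=0$ for all $k=0,\dots,\beta-1$ and all $l=1,\dots,\alpha-1$; 3) $V_{g_1}g_2(u+Bk,0)=0$ for all $k=1,\dots,\beta-1$ such that $u+Bk\notin\operatorname{supp}(h)$; 4) $V_{g_1}g_2(u+Bk,0)=\dfrac{h(u+Bk)}{h(u)}\,V_{g_1}g_2(u,0)$ for all $k=1,\dots,\beta-1$ such that $u+Bk\in\operatorname{supp}(h)$. Vice versa, if there are windows $g_1,g_2\in\mathbb{C}^N$ fulfilling 1)–4) for every $u\in\operatorname{supp}(h)$, then there exists a symbol $a\in\mathbb{C}^{N\times N}$ such that $H=\mathsf{G}^{g_1,g_2}_a$ (with lattice constants $\alpha,\beta$).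
   Context: $\mathbb{C}^N$ is identified with $\ell^2(\mathbb{Z}_N)$, and all indices are taken modulo $N$. For $f\in\mathbb{C}^N$: $T_kf(t)=f(t-k)$, $M_lf(t)=e^{2\pi i lt/N}f(t)$, $\pi(k,l)=M_lT_k$, $\mathcal{I}f(t)=f(-t)$, $(f\ast g)(u)=\sum_{k=0}^{N-1}f(u-k)g(k)$. The STFT is $V_gf(u,v)=\sum_{k=0}^{N-1}f(k)\overline{g(k-u)}e^{-2\pi i kv/N}$. The LTI filter with impulse response $h$ is $Hf=h\ast f$. The (finite) Gabor multiplier with lattice constants $\alpha,\beta$, windows $g_1,g_2\in\mathbb{C}^N$ and symbol $a\in\mathbb{C}^{N\times N}$ is $$\mathsf{G}^{g_1,g_2}_af=\sum_{k=0}^{A-1}\sum_{l=0}^{B-1}a(\alpha k,\beta l)\,V_{g_1}f(\alpha k,\beta l)\,\pi(\alpha k,\beta l)g_2 .$$ $\operatorname{supp}(h)=\{u\in\mathbb{Z}_N:h(u)\ne0\}$. *)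

theory Defs
  imports Complex_Main
begin

text \<open>
  Elements of the space of functions on the integers modulo \<open>N\<close> are represented as
  \<open>N\<close>-periodic functions on all of \<open>int\<close>, so that index arithmetic modulo \<open>N\<close> is ordinary
  integer arithmetic.
\<close>

definition cyclic_signals :: "nat \<Rightarrow> (int \<Rightarrow> complex) set" where
  "cyclic_signals N = {f. \<forall>t. f (t + int N) = f t}"

definition cyclic_symbols :: "nat \<Rightarrow> (int \<Rightarrow> int \<Rightarrow> complex) set" where
  "cyclic_symbols N = {a. \<forall>u v. a (u + int N) v = a u v \<and> a u (v + int N) = a u v}"

definition translation :: "int \<Rightarrow> (int \<Rightarrow> complex) \<Rightarrow> int \<Rightarrow> complex" where
  "translation k f = (\<lambda>t. f (t - k))"

definition modulation :: "nat \<Rightarrow> int \<Rightarrow> (int \<Rightarrow> complex) \<Rightarrow> int \<Rightarrow> complex" where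
  "modulation N l f =
     (\<lambda>t. exp (2 * of_real pi * \<i> * of_int l * of_int t / of_nat N) * f t)"

definition tf_shift :: "nat \<Rightarrow> int \<Rightarrow> int \<Rightarrow> (int \<Rightarrow> complex) \<Rightarrow> int \<Rightarrow> complex" where
  "tf_shift N k l f = modulation N l (translation k f)"

definition time_reversal :: "(int \<Rightarrow> complex) \<Rightarrow> int \<Rightarrow> complex" where
  "time_reversal f = (\<lambda>t. f (- t))"

definition cyclic_conv ::
    "nat \<Rightarrow> (int \<Rightarrow> complex) \<Rightarrow> (int \<Rightarrow> complex) \<Rightarrow> int \<Rightarrow> complex" where
  "cyclic_conv N f g = (\<lambda>u. \<Sum>k<N. f (u - int k) * g (int k))"

text \<open>\<open>stft N g f\<close> is the transform of the signal \<open>f\<close> with respect to the window \<open>g\<close>.\<close>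

definition stft ::
    "nat \<Rightarrow> (int \<Rightarrow> complex) \<Rightarrow> (int \<Rightarrow> complex) \<Rightarrow> int \<Rightarrow> int \<Rightarrow> complex" where
  "stft N g f u v =
     (\<Sum>k<N. f (int k) * cnj (g (int k - u)) *
        exp (- (2 * of_real pi * \<i> * of_nat k * of_int v / of_nat N)))"

definition lti_filter ::
    "nat \<Rightarrow> (int \<Rightarrow> complex) \<Rightarrow> (int \<Rightarrow> complex) \<Rightarrow> int \<Rightarrow> complex" where
  "lti_filter N h f = cyclic_conv N h f"

definition gabor_multiplier ::
    "nat \<Rightarrow> nat \<Rightarrow> nat \<Rightarrow> (int \<Rightarrow> complex) \<Rightarrow> (int \<Rightarrow> complex) \<Rightarrow>
     (int \<Rightarrow> int \<Rightarrow> complex) \<Rightarrow> (int \<Rightarrow> complex) \<Rightarrow> int \<Rightarrow> complex" where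
  "gabor_multiplier N \<alpha> \<beta> g1 g2 a f =
     (\<lambda>t. \<Sum>k<N div \<alpha>. \<Sum>l<N div \<beta>.
        a (int (\<alpha> * k)) (int (\<beta> * l)) * stft N g1 f (int (\<alpha> * k)) (int (\<beta> * l)) *
        tf_shift N (int (\<alpha> * k)) (int (\<beta> * l)) g2 t)"

text \<open>
  For a periodic \<open>h\<close> this is a union of residue classes modulo \<open>N\<close>, so membership of an integer
  means membership of its residue class.
\<close>

definition signal_supp :: "(int \<Rightarrow> complex) \<Rightarrow> int set" where
  "signal_supp h = {u. h u \<noteq> 0}"

definition filter_window_conditions ::
    "nat \<Rightarrow> nat \<Rightarrow> nat \<Rightarrow> (int \<Rightarrow> complex) \<Rightarrow> (int \<Rightarrow> complex) \<Rightarrow> (int \<Rightarrow> complex) \<Rightarrow>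
     int \<Rightarrow> bool" where
  "filter_window_conditions N \<alpha> \<beta> h g1 g2 u \<longleftrightarrow>
     (let A = N div \<alpha>; B = N div \<beta>; V = stft N g1 g2 in
       (V u 0 = cyclic_conv N (\<lambda>t. cnj (time_reversal g1 t)) g2 u \<and> V u 0 \<noteq> 0) \<and>
       (\<forall>k\<in>{0..<\<beta>}. \<forall>l\<in>{1..<\<alpha>}. V (u + int (B * k)) (int (l * A)) = 0) \<and>
       (\<forall>k\<in>{1..<\<beta>}. u + int (B * k) \<notin> signal_supp h \<longrightarrow> V (u + int (B * k)) 0 = 0) \<and>
       (\<forall>k\<in>{1..<\<beta>}. u + int (B * k) \<in> signal_supp h \<longrightarrow>
          V (u + int (B * k)) 0 = h (u + int (B * k)) / h u * V u 0))"

end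

theory Submission
  imports Defs "HOL-Analysis.Complex_Transcendental"
begin

text \<open>
  Both operators are integral operators. Along the diagonal \<open>t - s = u\<close> the kernel of the filter
  is the constant \<open>h u\<close>, and that of the multiplier is
  \<open>\<Sum>k. c k u * F u (s - \<alpha> k)\<close>, where \<open>F u x = cnj (g1 x) * g2 (x + u)\<close> and
  \<open>c k u = \<Sum>l. a (\<alpha> k) (\<beta> l) exp (2 \<pi> \<i> \<beta> l u / N)\<close> is \<open>B\<close>-periodic in \<open>u\<close>.
  The Fourier coefficients of \<open>F u\<close> are, up to a phase, the values \<open>V u v\<close> of the transform of the
  windows. Comparing the Fourier coefficients of the kernels in \<open>s\<close> at the frequencies \<open>l A\<close>,
  where the factor contributed by \<open>c\<close> is \<open>\<Sum>k. c k u\<close> independently of \<open>l\<close>, gives the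
  conditions. Conversely, the symbol can be chosen independent of its first argument: by Poisson
  summation the conditions make the \<open>\<alpha>\<close>-periodization of \<open>F u\<close> constant whenever \<open>h\<close> does not
  vanish on the class of \<open>u\<close> modulo \<open>B\<close>, and proportional to \<open>h u\<close> on that class.
\<close>

section \<open>Characters of the integers modulo \<open>n\<close> and their orthogonality\<close>

definition char_mod :: "nat \<Rightarrow> int \<Rightarrow> complex" where
  "char_mod n x = exp (2 * of_real pi * \<i> * of_int x / of_nat n)"

lemma char_mod_0 [simp]: "char_mod n 0 = 1"
  by (simp add: char_mod_def)

lemma char_mod_add: "char_mod n (x + y) = char_mod n x * char_mod n y"
  by (simp add: char_mod_def distrib_left add_divide_distrib flip: exp_add)

lemma char_mod_nonzero [simp]: "char_mod n x \<noteq> 0"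
  by (simp add: char_mod_def)

lemma char_mod_power: "char_mod n x ^ l = char_mod n (int l * x)"
  by (induction l) (simp_all add: char_mod_add distrib_right)

lemma char_mod_eq_1_iff:
  assumes "n > 0"
  shows "char_mod n x = 1 \<longleftrightarrow> int n dvd x"
proof -
  have "char_mod n x = exp (2 * of_real pi * \<i> * (of_int x / of_nat n))"
    by (simp add: char_mod_def)
  also have "\<dots> = 1 \<longleftrightarrow> (\<exists>m::int. 2 * pi * (of_int x / of_nat n) = of_int (2 * m) * pi)"
    by (simp add: exp_eq_1 Re_divide_of_nat Im_divide_of_nat)
  also have "\<dots> \<longleftrightarrow> (\<exists>m::int. real_of_int x = real_of_int (int n * m))"
    using assms by (simp add: field_simps)
  also have "\<dots> \<longleftrightarrow> int n dvd x"
    unfolding of_int_eq_iff by (auto simp: dvd_def)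
  finally show ?thesis .
qed

lemma char_mod_cong:
  assumes "n > 0" "int n dvd x - y"
  shows "char_mod n x = char_mod n y"
  using char_mod_add[of n "x - y" y] char_mod_eq_1_iff[OF assms(1), of "x - y"] assms(2) by simp

lemma char_mod_mult_cancel:
  assumes "m > 0"
  shows "char_mod (m * n) (int m * x) = char_mod n x"
  using assms by (simp add: char_mod_def mult_ac)

text \<open>\<open>char_mod n x\<close> is an \<open>n\<close>-th root of unity, so this is a
  geometric sum that vanishes unless the root is 1.\<close>

lemma sum_char_mod:
  assumes "n > 0"
  shows "(\<Sum>l<n. char_mod n (int l * x)) = (if int n dvd x then of_nat n else 0)"
proof -
  have "char_mod n x ^ n = 1"
    using assms by (simp add: char_mod_power char_mod_eq_1_iff)
  then have "(\<Sum>l<n. char_mod n x ^ l) = (if char_mod n x = 1 then of_nat n else 0)"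
    using geometric_sum[of "char_mod n x" n] by auto
  then show ?thesis
    using assms by (simp add: char_mod_power char_mod_eq_1_iff)
qed

section \<open>Sums of periodic functions over one period, and Poisson summation\<close>

lemma periodic_cong:
  fixes f :: "int \<Rightarrow> 'a"
  assumes "\<And>t. f (t + p) = f t" "p dvd x - y"
  shows "f x = f y"
proof -
  have "f (t + p * m) = f t" for t m
  proof (induction m arbitrary: t rule: int_induct[where k = 0])
    case (step1 m)
    then show ?case using assms(1)[of "t + p * m"] by (simp add: algebra_simps)
  next
    case (step2 m)
    then show ?case using assms(1)[of "t + p * (m - 1)"] by (simp add: algebra_simps)
  qed simp
  moreover obtain m where "x - y = p * m" using assms(2) by (auto simp: dvd_def)
  ultimately show ?thesis by (metis add.commute diff_add_cancel)
qed

text \<open>Moving the window of summation by one changes the sum by a telescoping difference of two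
  values one period apart, that is, by zero. Induction in both directions covers all integers
  \<open>u\<close>.\<close>

lemma sum_periodic_shift:
  fixes f :: "int \<Rightarrow> 'a::ab_group_add"
  assumes "\<And>t. f (t + int n) = f t"
  shows "(\<Sum>x<n. f (int x + u)) = (\<Sum>x<n. f (int x))"
proof -
  have step: "(\<Sum>x<n. f (int x + (v + 1))) = (\<Sum>x<n. f (int x + v))" for v
  proof -
    have "(\<Sum>x<n. f (int x + (v + 1))) - (\<Sum>x<n. f (int x + v))
        = (\<Sum>x<n. f (int (Suc x) + v) - f (int x + v))"
      by (simp add: sum_subtractf algebra_simps)
    also have "\<dots> = f (int n + v) - f v"
      using sum_lessThan_telescope[of "\<lambda>x. f (int x + v)" n] by simp
    also have "\<dots> = 0" using assms[of v] by (simp add: add.commute)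
    finally show ?thesis by simp
  qed
  show ?thesis
  proof (induction u rule: int_induct[where k = 0])
    case (step1 u)
    then show ?case using step[of u] by simp
  next
    case (step2 u)
    then show ?case using step[of "u - 1"] by simp
  qed simp
qed

text \<open>Summing in reverse order yields the arguments \<open>- (x + 1)\<close> up to a period;
  the surplus shift by one is absorbed by \<open>sum_periodic_shift\<close>.\<close>

lemma sum_periodic_uminus:
  fixes f :: "int \<Rightarrow> 'a::ab_group_add"
  assumes "\<And>t. f (t + int n) = f t"
  shows "(\<Sum>x<n. f (- int x)) = (\<Sum>x<n. f (int x))"
proof -
  have "(\<Sum>x<n. f (int x)) = (\<Sum>x<n. f (int (n - Suc x)))"
    by (rule sum.nat_diff_reindex[symmetric])
  also have "\<dots> = (\<Sum>x<n. f (- (int x + 1)))"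
    using assms[of "- (int x + 1)" for x] by (intro sum.cong) (auto simp: of_nat_diff algebra_simps)
  also have "\<dots> = (\<Sum>x<n. f (- int x))"
  proof (rule sum_periodic_shift)
    show "f (- (t + int n)) = f (- t)" for t using assms[of "- (t + int n)"] by simp
  qed
  finally show ?thesis by simp
qed

lemma sum_multiples:
  fixes f :: "nat \<Rightarrow> 'a::comm_monoid_add"
  assumes "m > 0"
  shows "(\<Sum>x<m * n. if m dvd x then f x else 0) = (\<Sum>k<n. f (m * k))"
proof -
  have "(\<Sum>x<m * n. if m dvd x then f x else 0) = sum f {x \<in> {..<m * n}. m dvd x}"
    by (rule sum.inter_filter[symmetric]) simp
  also have "{x \<in> {..<m * n}. m dvd x} = (*) m ` {..<n}"
    using assms by (auto simp: dvd_def)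
  also have "sum f \<dots> = (\<Sum>k<n. f (m * k))"
    using assms by (subst sum.reindex) (auto simp: inj_on_def)
  finally show ?thesis .
qed

text \<open>After the Fourier coefficients are expanded and the sums exchanged, the sum over
  \<open>l\<close> is a full character sum modulo \<open>m\<close>, which selects the
  \<open>x\<close> congruent to \<open>s\<close>.\<close>

lemma poisson_summation:
  fixes f :: "int \<Rightarrow> complex"
  assumes "m > 0" "n > 0" and per: "\<And>t. f (t + int (m * n)) = f t"
  shows "of_nat m * (\<Sum>k<n. f (s - int (m * k)))
    = (\<Sum>l<m. (\<Sum>x<m * n. f (int x) * char_mod (m * n) (- (int x * int (l * n)))) *
          char_mod (m * n) (int (l * n) * s))"
proof -
  have ch: "char_mod (m * n) (- (x * int (l * n))) * char_mod (m * n) (int (l * n) * s)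
      = char_mod m (int l * (s - x))" for x l
    using char_mod_mult_cancel[OF assms(2), of m "int l * (s - x)"]
    by (simp add: algebra_simps flip: char_mod_add)
  \<comment> \<open>At \<open>s - x\<close> this keeps \<open>f x\<close> exactly when
    \<open>x\<close> is congruent to \<open>s\<close> modulo \<open>m\<close>. Being periodic, it
    may be reflected and shifted so that the surviving indices become the multiples of
    \<open>m\<close>.\<close>
  define g where "g = (\<lambda>y. if int m dvd y then f (s - y) else 0)"
  have g_periodic: "g (t + int (m * n)) = g t" for t
    using per[of "s - (t + int (m * n))"] by (simp add: g_def dvd_add_left_iff)
  have "(\<Sum>l<m. (\<Sum>x<m * n. f (int x) * char_mod (m * n) (- (int x * int (l * n)))) *
          char_mod (m * n) (int (l * n) * s))
      = (\<Sum>l<m. \<Sum>x<m * n. f (int x) * char_mod m (int l * (s - int x)))"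
    unfolding sum_distrib_right mult.assoc ch ..
  also have "\<dots> = (\<Sum>x<m * n. f (int x) * (\<Sum>l<m. char_mod m (int l * (s - int x))))"
    unfolding sum_distrib_left by (rule sum.swap)
  also have "\<dots> = of_nat m * (\<Sum>x<m * n. g (s - int x))"
  proof -
    have "f (int x) * (\<Sum>l<m. char_mod m (int l * (s - int x))) = of_nat m * g (s - int x)" for x
      using assms(1) by (simp add: g_def sum_char_mod)
    then show ?thesis by (simp only: sum_distrib_left[of "of_nat m"])
  qed
  also have "(\<Sum>x<m * n. g (s - int x)) = (\<Sum>x<m * n. g (- int x + s))"
    by simp
  also have "\<dots> = (\<Sum>x<m * n. g (int x + s))"
  proof (rule sum_periodic_uminus)
    show "g (t + int (m * n) + s) = g (t + s)" for t
      using g_periodic[of "t + s"] by (simp only: add_ac)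
  qed
  also have "\<dots> = (\<Sum>x<m * n. g (int x))"
    using g_periodic by (rule sum_periodic_shift)
  also have "\<dots> = (\<Sum>k<n. f (s - int (m * k)))"
    using sum_multiples[OF assms(1), of "\<lambda>x. f (s - int x)" n] by (simp add: g_def)
  finally show ?thesis by simp
qed

section \<open>The transform of the windows as a Fourier coefficient\<close>

text \<open>The Fourier coefficient at \<open>v\<close> of the function \<open>F u\<close> of the
  overview. It differs from \<open>stft\<close> by a phase that is never zero and equals 1 at
  \<open>v = 0\<close>, so the conditions on the windows read the same for both.\<close>

definition window_dft ::
    "nat \<Rightarrow> (int \<Rightarrow> complex) \<Rightarrow> (int \<Rightarrow> complex) \<Rightarrow> int \<Rightarrow> int \<Rightarrow> complex" where
  "window_dft N g1 g2 u v =
     (\<Sum>x<N. cnj (g1 (int x)) * g2 (int x + u) * char_mod N (- (int x * v)))"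

lemma cyclic_signals_add: "f \<in> cyclic_signals N \<Longrightarrow> f (t + int N) = f t"
  by (simp add: cyclic_signals_def)

lemma cyclic_signals_cong: "f \<in> cyclic_signals N \<Longrightarrow> int N dvd x - y \<Longrightarrow> f x = f y"
  using periodic_cong[of f "int N" x y] by (simp add: cyclic_signals_add)

lemma stft_char_mod:
  "stft N g f u v = (\<Sum>k<N. f (int k) * cnj (g (int k - u)) * char_mod N (- (int k * v)))"
  by (simp add: stft_def char_mod_def mult.assoc)

lemma stft_eq_window_dft:
  assumes "N > 0" "g1 \<in> cyclic_signals N" "g2 \<in> cyclic_signals N"
  shows "stft N g1 g2 u v = char_mod N (- (u * v)) * window_dft N g1 g2 u v"
proof -
  let ?f = "\<lambda>x. g2 x * cnj (g1 (x - u)) * char_mod N (- (x * v))"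
  have "?f (t + int N) = ?f t" for t
    using cyclic_signals_cong[OF assms(3), of "t + int N" t]
      cyclic_signals_cong[OF assms(2), of "t + int N - u" "t - u"]
      char_mod_cong[OF assms(1), of "- ((t + int N) * v)" "- (t * v)"]
    by (simp add: algebra_simps)
  then have "(\<Sum>x<N. ?f (int x + u)) = stft N g1 g2 u v"
    unfolding stft_char_mod by (rule sum_periodic_shift)
  moreover have "?f (int x + u)
      = char_mod N (- (u * v)) * (cnj (g1 (int x)) * g2 (int x + u) * char_mod N (- (int x * v)))" for x
    using char_mod_add[of N "- (int x * v)" "- (u * v)"] by (simp add: algebra_simps)
  ultimately show ?thesis
    by (simp only: window_dft_def sum_distrib_left)
qed

lemma window_dft_cong:
  assumes "g2 \<in> cyclic_signals N" "int N dvd u - u'"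
  shows "window_dft N g1 g2 u v = window_dft N g1 g2 u' v"
proof -
  have "g2 (int x + u) = g2 (int x + u')" for x
    using assms by (intro cyclic_signals_cong) auto
  then show ?thesis by (simp add: window_dft_def)
qed

section \<open>Kernels of the two operators\<close>

text \<open>This is \<open>c k u\<close> of the overview: an unnormalised inverse Fourier transform
  of the symbol in its second argument, at the \<open>k\<close>-th lattice point in time.\<close>

definition symbol_sum :: "nat \<Rightarrow> nat \<Rightarrow> nat \<Rightarrow> (int \<Rightarrow> int \<Rightarrow> complex) \<Rightarrow> nat \<Rightarrow> int \<Rightarrow> complex" where
  "symbol_sum N \<alpha> \<beta> a k u =
     (\<Sum>l<N div \<beta>. a (int (\<alpha> * k)) (int (\<beta> * l)) * char_mod N (int (\<beta> * l) * u))"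

definition gabor_kernel ::
    "nat \<Rightarrow> nat \<Rightarrow> nat \<Rightarrow> (int \<Rightarrow> complex) \<Rightarrow> (int \<Rightarrow> complex) \<Rightarrow>
     (int \<Rightarrow> int \<Rightarrow> complex) \<Rightarrow> int \<Rightarrow> int \<Rightarrow> complex" where
  "gabor_kernel N \<alpha> \<beta> g1 g2 a t s =
     (\<Sum>k<N div \<alpha>. symbol_sum N \<alpha> \<beta> a k (t - s) *
        (cnj (g1 (s - int (\<alpha> * k))) * g2 (t - int (\<alpha> * k))))"

text \<open>The phases of the transform and of the modulation combine to a character at
  \<open>t - s\<close>, so all dependence on the frequency index is collected in
  \<open>symbol_sum\<close>.\<close>

lemma gabor_multiplier_eq_kernel:
  "gabor_multiplier N \<alpha> \<beta> g1 g2 a f t = (\<Sum>s<N. gabor_kernel N \<alpha> \<beta> g1 g2 a t (int s) * f (int s))"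
proof -
  have tf: "tf_shift N u v g2 t = char_mod N (v * t) * g2 (t - u)" for u v
    by (simp add: tf_shift_def modulation_def translation_def char_mod_def mult.assoc)
  have "gabor_multiplier N \<alpha> \<beta> g1 g2 a f t =
      (\<Sum>k<N div \<alpha>. \<Sum>l<N div \<beta>. \<Sum>s<N.
         a (int (\<alpha> * k)) (int (\<beta> * l)) * char_mod N (int (\<beta> * l) * (t - int s)) *
         (cnj (g1 (int s - int (\<alpha> * k))) * g2 (t - int (\<alpha> * k))) * f (int s))"
    unfolding gabor_multiplier_def stft_char_mod tf sum_distrib_left sum_distrib_right
  proof (intro sum.cong refl)
    fix k l s
    have "char_mod N (int (\<beta> * l) * (t - int s))
        = char_mod N (- (int s * int (\<beta> * l))) * char_mod N (int (\<beta> * l) * t)"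
      by (simp add: algebra_simps flip: char_mod_add)
    then show "a (int (\<alpha> * k)) (int (\<beta> * l)) *
         (f (int s) * cnj (g1 (int s - int (\<alpha> * k))) * char_mod N (- (int s * int (\<beta> * l)))) *
         (char_mod N (int (\<beta> * l) * t) * g2 (t - int (\<alpha> * k)))
       = a (int (\<alpha> * k)) (int (\<beta> * l)) * char_mod N (int (\<beta> * l) * (t - int s)) *
         (cnj (g1 (int s - int (\<alpha> * k))) * g2 (t - int (\<alpha> * k))) * f (int s)"
      by (simp only: mult_ac)
  qed
  also have "\<dots> = (\<Sum>k<N div \<alpha>. \<Sum>s<N. \<Sum>l<N div \<beta>.
         a (int (\<alpha> * k)) (int (\<beta> * l)) * char_mod N (int (\<beta> * l) * (t - int s)) *
         (cnj (g1 (int s - int (\<alpha> * k))) * g2 (t - int (\<alpha> * k))) * f (int s))"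
    by (intro sum.cong refl sum.swap)
  also have "\<dots> = (\<Sum>s<N. \<Sum>k<N div \<alpha>. \<Sum>l<N div \<beta>.
         a (int (\<alpha> * k)) (int (\<beta> * l)) * char_mod N (int (\<beta> * l) * (t - int s)) *
         (cnj (g1 (int s - int (\<alpha> * k))) * g2 (t - int (\<alpha> * k))) * f (int s))"
    by (rule sum.swap)
  finally show ?thesis
    by (simp only: gabor_kernel_def symbol_sum_def sum_distrib_right)
qed

text \<open>The unit vectors of the signal space; divisibility makes them periodic on all of
  \<open>int\<close>.\<close>

definition periodic_delta :: "nat \<Rightarrow> int \<Rightarrow> int \<Rightarrow> complex" where
  "periodic_delta N s t = (if int N dvd t - s then 1 else 0)"

lemma periodic_delta_cyclic: "periodic_delta N s \<in> cyclic_signals N"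
proof -
  have "int N dvd t + int N - s \<longleftrightarrow> int N dvd t - s" for t
    using dvd_add_left_iff[of "int N" "int N" "t - s"] by (simp add: algebra_simps)
  then show ?thesis by (simp add: cyclic_signals_def periodic_delta_def)
qed

lemma sum_periodic_delta:
  assumes "s < N"
  shows "(\<Sum>x<N. f x * periodic_delta N (int s) (int x)) = f s"
proof -
  have "int N dvd int x - int s \<longleftrightarrow> x = s" if "x < N" for x
    using that assms zdvd_imp_le[of "int N" "int x - int s"] zdvd_imp_le[of "int N" "int s - int x"]
    by (cases x s rule: linorder_cases) (auto simp: dvd_diff_commute)
  then have "(\<Sum>x<N. f x * periodic_delta N (int s) (int x)) = (\<Sum>x<N. if x = s then f x else 0)"
    by (intro sum.cong) (auto simp: periodic_delta_def)
  then show ?thesis using assms by simp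
qed

text \<open>Both operators sum a kernel against \<open>f\<close> over \<open>0 \<le> s < N\<close>,
  and applying them to \<open>periodic_delta\<close> reads off the column at
  \<open>s\<close>.\<close>

lemma lti_filter_eq_gabor_multiplier_iff:
  "(\<forall>f\<in>cyclic_signals N. lti_filter N h f = gabor_multiplier N \<alpha> \<beta> g1 g2 a f) \<longleftrightarrow>
   (\<forall>t. \<forall>s<N. gabor_kernel N \<alpha> \<beta> g1 g2 a t (int s) = h (t - int s))"
  (is "?L \<longleftrightarrow> ?R")
proof
  assume ?L
  show ?R
  proof (intro allI impI)
    fix t s assume "s < N"
    have "lti_filter N h (periodic_delta N (int s)) t
        = gabor_multiplier N \<alpha> \<beta> g1 g2 a (periodic_delta N (int s)) t"
      using \<open>?L\<close> periodic_delta_cyclic by metis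
    then show "gabor_kernel N \<alpha> \<beta> g1 g2 a t (int s) = h (t - int s)"
      unfolding gabor_multiplier_eq_kernel lti_filter_def cyclic_conv_def
        sum_periodic_delta[OF \<open>s < N\<close>] by simp
  qed
next
  assume ?R
  then show ?L
    by (auto simp: fun_eq_iff gabor_multiplier_eq_kernel lti_filter_def cyclic_conv_def
        intro!: sum.cong)
qed

section \<open>From the multiplier representation to the conditions\<close>

text \<open>
  At a frequency \<open>l * (N div \<alpha>)\<close> the shifts by multiples of \<open>\<alpha>\<close> in the kernel contribute no phase,
  so the sum over \<open>k\<close> factors out.
\<close>

lemma gabor_kernel_dft:
  fixes l :: nat
  assumes "N > 0" "\<alpha> dvd N" "g1 \<in> cyclic_signals N" "g2 \<in> cyclic_signals N"
  defines "v \<equiv> int (l * (N div \<alpha>))"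
  shows "(\<Sum>s<N. gabor_kernel N \<alpha> \<beta> g1 g2 a (int s + u) (int s) * char_mod N (- (int s * v)))
    = (\<Sum>k<N div \<alpha>. symbol_sum N \<alpha> \<beta> a k u) * window_dft N g1 g2 u v"
proof -
  let ?F = "\<lambda>x. cnj (g1 x) * g2 (x + u) * char_mod N (- (x * v))"
  have per: "?F (t + int N) = ?F t" for t
    using cyclic_signals_cong[OF assms(3), of "t + int N" t]
      cyclic_signals_cong[OF assms(4), of "t + int N + u" "t + u"]
      char_mod_cong[OF assms(1), of "- ((t + int N) * v)" "- (t * v)"]
    by (simp add: algebra_simps)
  have "int \<alpha> * v = int N * int l"
    using assms(2) unfolding v_def by (metis dvd_mult_div_cancel mult.assoc mult.commute of_nat_mult)
  then have phase: "char_mod N (- (x * v)) = char_mod N (- ((x - int (\<alpha> * k)) * v))" for x k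
  proof (intro char_mod_cong assms(1))
    have "- (x * v) - - ((x - int (\<alpha> * k)) * v) = - (int \<alpha> * v * int k)"
      by (simp add: algebra_simps)
    then show "int N dvd - (x * v) - - ((x - int (\<alpha> * k)) * v)"
      using \<open>int \<alpha> * v = int N * int l\<close> by simp
  qed
  have "(\<Sum>s<N. gabor_kernel N \<alpha> \<beta> g1 g2 a (int s + u) (int s) * char_mod N (- (int s * v)))
      = (\<Sum>s<N. \<Sum>k<N div \<alpha>. symbol_sum N \<alpha> \<beta> a k u * ?F (int s - int (\<alpha> * k)))"
    unfolding gabor_kernel_def sum_distrib_right
  proof (intro sum.cong refl)
    fix s k
    have *: "int s + u - int s = u" "int s + u - int (\<alpha> * k) = int s - int (\<alpha> * k) + u"
      by simp_all
    show "symbol_sum N \<alpha> \<beta> a k (int s + u - int s) *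
          (cnj (g1 (int s - int (\<alpha> * k))) * g2 (int s + u - int (\<alpha> * k))) *
          char_mod N (- (int s * v)) = symbol_sum N \<alpha> \<beta> a k u * ?F (int s - int (\<alpha> * k))"
      unfolding * phase[of "int s" k] by (simp only: mult.assoc)
  qed
  also have "\<dots> = (\<Sum>k<N div \<alpha>. \<Sum>s<N. symbol_sum N \<alpha> \<beta> a k u * ?F (int s - int (\<alpha> * k)))"
    by (rule sum.swap)
  also have "\<dots> = (\<Sum>k<N div \<alpha>. symbol_sum N \<alpha> \<beta> a k u * (\<Sum>s<N. ?F (int s)))"
    using sum_periodic_shift[of ?F N "- int (\<alpha> * k)" for k, OF per]
    by (simp only: diff_conv_add_uminus flip: sum_distrib_left)
  finally show ?thesis
    by (simp add: window_dft_def sum_distrib_right)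
qed

text \<open>The frequency \<open>\<beta> * l\<close> times the shift is a multiple of
  \<open>N\<close>. This periodicity is what links the values of \<open>h\<close> and of the window
  transform at \<open>u\<close> and \<open>u + B k\<close>.\<close>

lemma symbol_sum_shift:
  assumes "N > 0" "\<beta> dvd N"
  shows "symbol_sum N \<alpha> \<beta> a k (u + int (N div \<beta> * m)) = symbol_sum N \<alpha> \<beta> a k u"
proof -
  have "char_mod N (int (\<beta> * l) * (u + int (N div \<beta> * m))) = char_mod N (int (\<beta> * l) * u)" for l
  proof (intro char_mod_cong assms(1))
    obtain q where q: "N = \<beta> * q" using assms(2) by auto
    then have "q = N div \<beta>" using assms(1) by auto
    then have "int (\<beta> * l) * (u + int (N div \<beta> * m)) - int (\<beta> * l) * u = int N * (int l * int m)"
      using q by (simp add: algebra_simps)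
    then show "int N dvd int (\<beta> * l) * (u + int (N div \<beta> * m)) - int (\<beta> * l) * u" by simp
  qed
  then show ?thesis by (simp add: symbol_sum_def)
qed

lemma conditions_if_gabor_multiplier:
  assumes N: "N > 0" and "\<alpha> dvd N" "\<beta> dvd N"
    and g: "g1 \<in> cyclic_signals N" "g2 \<in> cyclic_signals N"
    and eq: "\<forall>f\<in>cyclic_signals N. lti_filter N h f = gabor_multiplier N \<alpha> \<beta> g1 g2 a f"
    and u: "u \<in> signal_supp h"
  shows "filter_window_conditions N \<alpha> \<beta> h g1 g2 u"
proof -
  define C where "C u = (\<Sum>k<N div \<alpha>. symbol_sum N \<alpha> \<beta> a k u)" for u
  define W where "W = window_dft N g1 g2"
  obtain A where A: "N = \<alpha> * A" using \<open>\<alpha> dvd N\<close> by auto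
  then have pos: "\<alpha> > 0" "A > 0" and NA: "N div \<alpha> = A" using N by auto
  \<comment> \<open>The filter kernel is constant along a diagonal, so its Fourier coefficients
    vanish except at multiples of \<open>N\<close>.\<close>
  have *: "C u * W u (int (l * A)) = (if \<alpha> dvd l then of_nat N * h u else 0)" for u l
  proof -
    have "C u * W u (int (l * A)) = (\<Sum>s<N. h u * char_mod N (int s * (- int (l * A))))"
      using eq gabor_kernel_dft[OF N \<open>\<alpha> dvd N\<close> g, of \<beta> a u l]
      by (simp add: lti_filter_eq_gabor_multiplier_iff C_def W_def NA)
    also have "\<dots> = h u * (if int N dvd int (l * A) then of_nat N else 0)"
      by (simp only: sum_char_mod[OF N] dvd_minus_iff flip: sum_distrib_left)
    also have "int N dvd int (l * A) \<longleftrightarrow> \<alpha> dvd l"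
      using pos unfolding int_dvd_int_iff A by simp
    finally show ?thesis by simp
  qed
  have C_shift: "C (u + int (N div \<beta> * k)) = C u" for u k
    using N \<open>\<beta> dvd N\<close> by (simp only: C_def symbol_sum_shift)
  have V: "stft N g1 g2 x y = char_mod N (- (x * y)) * W x y" for x y
    using stft_eq_window_dft[OF N g] by (simp add: W_def)
  have W0: "C x * W x 0 = of_nat N * h x" for x using *[of x 0] by simp
  have "h u \<noteq> 0" using u by (simp add: signal_supp_def)
  \<comment> \<open>The product \<open>C u * W u 0\<close> equals \<open>N * h u\<close>, which is
    nonzero on the support. By periodicity \<open>C u\<close> can then be cancelled at every
    \<open>u + B k\<close>.\<close>
  then have nz: "C u \<noteq> 0" "W u 0 \<noteq> 0" using W0[of u] N by auto
  have "stft N g1 g2 u 0 = cyclic_conv N (\<lambda>t. cnj (time_reversal g1 t)) g2 u"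
    by (simp add: stft_def cyclic_conv_def time_reversal_def mult.commute)
  moreover have "W (u + int (N div \<beta> * k)) (int (l * A)) = 0" if "l \<in> {1..<\<alpha>}" for k l
  proof -
    have "\<not> \<alpha> dvd l" using that by (auto dest: dvd_imp_le)
    then have "C u * W (u + int (N div \<beta> * k)) (int (l * A)) = 0"
      using *[of "u + int (N div \<beta> * k)" l] unfolding C_shift by (simp only: if_False)
    then show ?thesis using nz(1) unfolding mult_eq_0_iff by blast
  qed
  \<comment> \<open>Conditions 3) and 4) in one formula: off the support the right-hand side is
    zero.\<close>
  moreover have "W (u + int (N div \<beta> * k)) 0 = h (u + int (N div \<beta> * k)) / h u * W u 0" for k
  proof -
    have "C u * (W (u + int (N div \<beta> * k)) 0 * h u) = C u * (h (u + int (N div \<beta> * k)) * W u 0)"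
      using W0[of "u + int (N div \<beta> * k)"] W0[of u] unfolding C_shift by algebra
    then show ?thesis using nz(1) \<open>h u \<noteq> 0\<close> by (simp add: eq_divide_eq)
  qed
  ultimately show ?thesis
    unfolding filter_window_conditions_def Let_def NA V
    using nz by (simp add: signal_supp_def)
qed

section \<open>From the conditions to a symbol\<close>

text \<open>Fourier inversion modulo \<open>B\<close>: as \<open>N = \<beta> * B\<close>, the
  frequencies \<open>\<beta> * l\<close> modulo \<open>N\<close> are the characters modulo
  \<open>B\<close>. Hence every \<open>B\<close>-periodic \<open>c\<close> arises from a symbol, the
  same for all \<open>k\<close>.\<close>

lemma symbol_sum_inverse_dft:
  fixes c :: "int \<Rightarrow> complex"
  assumes N: "N > 0" and "\<beta> dvd N"
  defines "B \<equiv> N div \<beta>"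
  defines "a \<equiv> \<lambda>u v. (\<Sum>m<B. c (int m) * char_mod N (- (v * int m))) / of_nat B"
  assumes c: "\<And>u. c (u + int B) = c u"
  shows "symbol_sum N \<alpha> \<beta> a k u = c u"
proof -
  obtain q where q: "N = \<beta> * q" using \<open>\<beta> dvd N\<close> by auto
  then have pos: "\<beta> > 0" "B > 0" and NB: "N = \<beta> * B" using N by (auto simp: B_def)
  have "char_mod N (- (int (\<beta> * l) * int m)) * char_mod N (int (\<beta> * l) * u)
      = char_mod B (int l * (u - int m))" for l m
    using char_mod_mult_cancel[OF pos(1), of B "int l * (u - int m)"]
    unfolding NB by (simp add: algebra_simps flip: char_mod_add)
  then have "symbol_sum N \<alpha> \<beta> a k u
      = (\<Sum>l<B. \<Sum>m<B. c (int m) * char_mod B (int l * (u - int m))) / of_nat B"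
    by (simp add: symbol_sum_def a_def sum_distrib_right sum_divide_distrib mult.assoc
        flip: B_def)
  also have "(\<Sum>l<B. \<Sum>m<B. c (int m) * char_mod B (int l * (u - int m)))
      = (\<Sum>m<B. c (int m) * (\<Sum>l<B. char_mod B (int l * (u - int m))))"
    unfolding sum_distrib_left by (rule sum.swap)
  also have "\<dots> = (\<Sum>m<B. of_nat B * (c (int m) * periodic_delta B u (int m)))"
    using pos by (intro sum.cong) (auto simp: sum_char_mod periodic_delta_def dvd_diff_commute)
  also have "\<dots> = of_nat B * (\<Sum>m<B. c (int m) * periodic_delta B u (int m))"
    by (simp add: sum_distrib_left)
  \<comment> \<open>\<open>sum_periodic_delta\<close> evaluates only at a natural number below
    \<open>B\<close>, hence the passage to the residue of \<open>u\<close>.\<close>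
  also have "periodic_delta B u = periodic_delta B (int (nat (u mod int B)))"
    using pos by (auto simp: periodic_delta_def fun_eq_iff mod_eq_dvd_iff[symmetric])
  also have "(\<Sum>m<B. c (int m) * periodic_delta B (int (nat (u mod int B))) (int m))
      = c (int (nat (u mod int B)))"
    using pos by (intro sum_periodic_delta) (simp add: nat_less_iff)
  also have "\<dots> = c u"
  proof (rule periodic_cong[of c "int B", OF c])
    show "int B dvd int (nat (u mod int B)) - u"
      using pos by (simp flip: mod_eq_dvd_iff)
  qed
  finally show ?thesis using pos by simp
qed

lemma gabor_multiplier_if_conditions:
  assumes N: "N > 0" and "\<alpha> dvd N" "\<beta> dvd N"
    and h: "h \<in> cyclic_signals N"
    and g: "g1 \<in> cyclic_signals N" "g2 \<in> cyclic_signals N"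
    and cond: "\<forall>u\<in>signal_supp h. filter_window_conditions N \<alpha> \<beta> h g1 g2 u"
  shows "\<exists>a\<in>cyclic_symbols N. \<forall>f\<in>cyclic_signals N.
           lti_filter N h f = gabor_multiplier N \<alpha> \<beta> g1 g2 a f"
proof -
  define W where "W = window_dft N g1 g2"
  obtain A where A: "N = \<alpha> * A" using \<open>\<alpha> dvd N\<close> by (rule dvdE)
  then have pos_A: "\<alpha> > 0" "A > 0" and NA: "N div \<alpha> = A" using N by auto
  obtain B where B: "N = \<beta> * B" using \<open>\<beta> dvd N\<close> by (rule dvdE)
  then have pos_B: "\<beta> > 0" "B > 0" and NB: "N div \<beta> = B" using N by auto
  note AB = A B and pos = pos_A pos_B
  have V: "stft N g1 g2 x y = char_mod N (- (x * y)) * W x y" for x y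
    using stft_eq_window_dft[OF N g] by (simp add: W_def)
  \<comment> \<open>Since \<open>\<beta> * B = N\<close>, each \<open>u\<close> in the class of
    \<open>w\<close> modulo \<open>B\<close> equals some \<open>w + B k\<close> with
    \<open>0 \<le> k < \<beta>\<close> up to a multiple of \<open>N\<close>. So the conditions at
    one support point \<open>w\<close> control its whole class.\<close>
  have shifts: "W u 0 = h u / h w * W w 0 \<and> (\<forall>l\<in>{1..<\<alpha>}. W u (int (l * A)) = 0) \<and> W w 0 \<noteq> 0"
    if hw: "h w \<noteq> 0" and uw: "u mod int B = w mod int B" for u w
  proof -
    obtain j where j: "u - w = int B * j" using uw by (auto simp: mod_eq_dvd_iff dvd_def)
    define k where "k = nat (j mod int \<beta>)"
    have k: "k < \<beta>" using pos by (simp add: k_def nat_less_iff)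
    have "int N dvd u - (w + int (B * k))"
    proof -
      have "u - (w + int (B * k)) = int B * (j - j mod int \<beta>)"
        using j pos by (simp add: k_def algebra_simps)
      also have "\<dots> = int N * (j div int \<beta>)"
        by (simp add: AB(2) minus_mod_eq_mult_div)
      finally show ?thesis by simp
    qed
    then have u: "W u v = W (w + int (B * k)) v" "h u = h (w + int (B * k))" for v
      unfolding W_def using window_dft_cong[OF g(2)] cyclic_signals_cong[OF h] by blast+
    have "filter_window_conditions N \<alpha> \<beta> h g1 g2 w"
      using cond hw by (simp add: signal_supp_def)
    then have c: "W w 0 \<noteq> 0" "\<forall>k\<in>{0..<\<beta>}. \<forall>l\<in>{1..<\<alpha>}. W (w + int (B * k)) (int (l * A)) = 0"
      "\<forall>k\<in>{1..<\<beta>}. W (w + int (B * k)) 0 = h (w + int (B * k)) / h w * W w 0"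
      unfolding filter_window_conditions_def Let_def NA NB V signal_supp_def by auto
    then show ?thesis
    proof (intro conjI ballI)
      show "W u 0 = h u / h w * W w 0"
        unfolding u using c(3) k hw by (cases "k = 0") auto
      show "W u (int (l * A)) = 0" if "l \<in> {1..<\<alpha>}" for l
        using c(2)[rule_format, of k l] k that unfolding u by simp
    qed (rule c(1))
  qed
  \<comment> \<open>The chosen support point depends on the residue class alone, which makes
    \<open>c\<close> periodic modulo \<open>B\<close>.\<close>
  define w where "w r = (SOME w. h w \<noteq> 0 \<and> w mod int B = r)" for r
  \<comment> \<open>The value is forced by the kernel equation at the chosen point, where the
    periodization equals \<open>W w 0 / \<alpha>\<close>. If \<open>h\<close> vanishes on the whole
    class, the kernel has to be zero there, and 0 serves.\<close>
  define c where "c u = (if \<exists>x. h x \<noteq> 0 \<and> x mod int B = u mod int B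
      then of_nat \<alpha> * h (w (u mod int B)) / W (w (u mod int B)) 0 else 0)" for u
  have cW: "c u * (\<Sum>k<A. cnj (g1 (s - int (\<alpha> * k))) * g2 (s - int (\<alpha> * k) + u)) = h u" for u s
  proof (cases "\<exists>x. h x \<noteq> 0 \<and> x mod int B = u mod int B")
    case True
    let ?w = "w (u mod int B)"
    have w: "h ?w \<noteq> 0 \<and> ?w mod int B = u mod int B"
      unfolding w_def by (rule someI_ex[OF True])
    then have *: "W u 0 = h u / h ?w * W ?w 0" "\<And>l. l \<in> {1..<\<alpha>} \<Longrightarrow> W u (int (l * A)) = 0" "W ?w 0 \<noteq> 0"
      using shifts[of ?w u] by auto
    have per: "cnj (g1 (t + int (\<alpha> * A))) * g2 (t + int (\<alpha> * A) + u) = cnj (g1 t) * g2 (t + u)" for t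
      using cyclic_signals_cong[OF g(1), of "t + int N" t]
        cyclic_signals_cong[OF g(2), of "t + int N + u" "t + u"]
      by (simp add: AB(1))
    have "of_nat \<alpha> * (\<Sum>k<A. cnj (g1 (s - int (\<alpha> * k))) * g2 (s - int (\<alpha> * k) + u))
        = (\<Sum>l<\<alpha>. W u (int (l * A)) * char_mod N (int (l * A) * s))"
      unfolding poisson_summation[of \<alpha> A "\<lambda>x. cnj (g1 x) * g2 (x + u)", OF pos(1,2) per]
        W_def window_dft_def AB(1) ..
    \<comment> \<open>Condition 2) removes every frequency except \<open>l = 0\<close>, and with it
      the dependence on \<open>s\<close>.\<close>
    also have "\<dots> = (\<Sum>l\<in>{0}. W u (int (l * A)) * char_mod N (int (l * A) * s))"
      using pos *(2) by (intro sum.mono_neutral_right) auto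
    finally have "(\<Sum>k<A. cnj (g1 (s - int (\<alpha> * k))) * g2 (s - int (\<alpha> * k) + u)) = W u 0 / of_nat \<alpha>"
      using pos by (simp add: eq_divide_eq mult.commute)
    moreover have "c u = of_nat \<alpha> * h ?w / W ?w 0" using True by (simp add: c_def)
    ultimately show ?thesis
      using *(1,3) w pos by (simp only:) simp
  next
    case False
    then show ?thesis by (auto simp: c_def)
  qed
  define a :: "int \<Rightarrow> int \<Rightarrow> complex"
    where "a = (\<lambda>u v. (\<Sum>m<N div \<beta>. c (int m) * char_mod N (- (v * int m))) / of_nat (N div \<beta>))"
  have "c (u + int B) = c u" for u unfolding c_def mod_add_self2 ..
  then have sym: "symbol_sum N \<alpha> \<beta> a k u = c u" for k u
    unfolding a_def using symbol_sum_inverse_dft[OF N \<open>\<beta> dvd N\<close>, of c] NB by simp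
  have "a \<in> cyclic_symbols N"
  proof -
    have "char_mod N (- ((v + int N) * int m)) = char_mod N (- (v * int m))" for v m
      using N by (intro char_mod_cong) (auto simp: algebra_simps)
    then show ?thesis by (simp add: cyclic_symbols_def a_def)
  qed
  moreover have "gabor_kernel N \<alpha> \<beta> g1 g2 a t (int s) = h (t - int s)" for t s
    using cW[of "t - int s" "int s"]
    by (simp add: gabor_kernel_def sym NA sum_distrib_left algebra_simps)
  ultimately show ?thesis
    by (auto simp: lti_filter_eq_gabor_multiplier_iff)
qed

theorem theorem6p6:
  fixes N \<alpha> \<beta> :: nat and h :: "int \<Rightarrow> complex"
  assumes "N \<ge> 1"
    and "\<alpha> \<ge> 1" and "\<alpha> dvd N"
    and "\<beta> \<ge> 1" and "\<beta> dvd N"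
    and "h \<in> cyclic_signals N"
  shows "(\<forall>g1\<in>cyclic_signals N. \<forall>g2\<in>cyclic_signals N. \<forall>a\<in>cyclic_symbols N.
            (\<forall>f\<in>cyclic_signals N. lti_filter N h f = gabor_multiplier N \<alpha> \<beta> g1 g2 a f) \<longrightarrow>
            (\<forall>u\<in>signal_supp h. filter_window_conditions N \<alpha> \<beta> h g1 g2 u)) \<and>
         (\<forall>g1\<in>cyclic_signals N. \<forall>g2\<in>cyclic_signals N.
            (\<forall>u\<in>signal_supp h. filter_window_conditions N \<alpha> \<beta> h g1 g2 u) \<longrightarrow>
            (\<exists>a\<in>cyclic_symbols N. \<forall>f\<in>cyclic_signals N.
               lti_filter N h f = gabor_multiplier N \<alpha> \<beta> g1 g2 a f))"
proof -
  have "N > 0" using \<open>N \<ge> 1\<close> by simp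
  show ?thesis
    using conditions_if_gabor_multiplier[OF \<open>N > 0\<close> \<open>\<alpha> dvd N\<close> \<open>\<beta> dvd N\<close>]
      gabor_multiplier_if_conditions[OF \<open>N > 0\<close> \<open>\<alpha> dvd N\<close> \<open>\<beta> dvd N\<close> \<open>h \<in> cyclic_signals N\<close>]
    by (intro conjI ballI impI) blast+
qed

end
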